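(* Let $n\geq3$ be an odd integer and $p\geq1$ an integer. Let $$\sigma(n,p)=\sum_{k=1}^{\frac{n-1}{2}}\tan^{2p}\frac{\pi k}{n}.$$ For integers $m\geq 0$, $q\geq 1$, $s\geq 0$ let $C_0(m,q,s)$ denote the number of $q$-tuples $(a_1,\dots,a_q)$ of integers with $0\leq a_i\leq s$ and $a_1+\dots+a_q=m$. Then $$\sigma(n,p)=\frac{n}{2}\sum_{j=0}^{(n-2)p}\left(\big(C_0(j,p,n-2)\big)^2+2\sum_{k=1}^{\left\lfloor\frac{(n-2)p-j}{n}\right\rfloor}(-1)^kC_0(j,p,n-2)\,C_0(j+nk,p,n-2)\right).$$
   Context: An empty inner sum (when its upper limit is less than $1$) equals $0$. *)

theory Defs
  imports Complex_Main
begin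

definition sigma :: "nat \<Rightarrow> nat \<Rightarrow> real" where
  "sigma n p = (\<Sum>k=1..(n - 1) div 2. tan (pi * real k / real n) ^ (2 * p))"

(* q-tuples are lists of length q; typing the entries as nat gives the lower bound 0. *)
definition C0 :: "nat \<Rightarrow> nat \<Rightarrow> nat \<Rightarrow> nat" where
  "C0 m q s = card {a :: nat list. length a = q \<and> (\<forall>x\<in>set a. x \<le> s) \<and> sum_list a = m}"

end

theory Submission
  imports Defs "HOL-Analysis.Complex_Transcendental"
begin

text \<open>
  The number \<open>C0 j p (n - 2)\<close> is the coefficient of \<open>z ^ j\<close> in \<open>P z ^ p\<close>, where
  \<open>P z = 1 + z + \<dots> + z ^ (n - 2)\<close>. If \<open>z ^ n = -1\<close> then \<open>z * P z = (1 + z) / (1 - z)\<close>; as \<open>n\<close>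
  is odd, these \<open>z\<close> are the numbers \<open>- cis (2 * pi * m / n)\<close> with \<open>m < n\<close>, for which
  \<open>norm (P z) = \<bar>tan (pi * m / n)\<bar>\<close>. Hence \<open>2 * sigma n p\<close> is the sum of \<open>norm (P z ^ p) ^ 2\<close> over
  the roots of \<open>z ^ n = -1\<close>. Expanding the square, the orthogonality of the roots of unity leaves
  only the pairs of exponents that are congruent modulo \<open>n\<close>.
\<close>

text \<open>Expanding the product picks one exponent from each of the \<open>q\<close> factors, and
  a list records the choices; the head of the list belongs to the factor split off in the
  induction.\<close>

lemma geometric_sum_power_lists:
  fixes z :: "'a::comm_semiring_1"
  shows "(\<Sum>j\<le>s. z ^ j) ^ q =
    (\<Sum>a\<in>{a :: nat list. length a = q \<and> (\<forall>x\<in>set a. x \<le> s)}. z ^ sum_list a)"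
proof (induction q)
  case 0
  have "{a :: nat list. length a = 0 \<and> (\<forall>x\<in>set a. x \<le> s)} = {[]}" by auto
  then show ?case by simp
next
  case (Suc q)
  let ?L = "\<lambda>q. {a :: nat list. length a = q \<and> (\<forall>x\<in>set a. x \<le> s)}"
  have L: "?L (Suc q) = (\<lambda>(x, a). x # a) ` ({..s} \<times> ?L q)"
    by (auto simp: length_Suc_conv image_iff)
  have inj: "inj_on (\<lambda>(x, a). x # a) ({..s} \<times> ?L q)"
    by (auto simp: inj_on_def)
  have "(\<Sum>a\<in>?L (Suc q). z ^ sum_list a) = (\<Sum>(x, a)\<in>{..s} \<times> ?L q. z ^ x * z ^ sum_list a)"
    unfolding L by (subst sum.reindex[OF inj]) (auto intro!: sum.cong simp: power_add)
  also have "\<dots> = (\<Sum>x\<le>s. z ^ x) * (\<Sum>a\<in>?L q. z ^ sum_list a)"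
    by (simp add: sum_product sum.cartesian_product)
  finally show ?case using Suc.IH by simp
qed

text \<open>Grouping the lists by their sum, which is at most \<open>s * q\<close>, leaves a fibre
  of \<open>C0 m q s\<close> lists over each \<open>m\<close>.\<close>

lemma geometric_sum_power_C0:
  fixes z :: "'a::comm_semiring_1"
  shows "(\<Sum>j\<le>s. z ^ j) ^ q = (\<Sum>m\<le>s * q. of_nat (C0 m q s) * z ^ m)"
proof -
  let ?L = "{a :: nat list. length a = q \<and> (\<forall>x\<in>set a. x \<le> s)}"
  have fin: "finite ?L"
    using finite_lists_length_eq[of "{..s}" q] by (rule rev_finite_subset) auto
  have "sum_list a \<le> s * q" if "a \<in> ?L" for a
  proof -
    have "sum_list a \<le> s * length a" if "\<forall>x\<in>set a. x \<le> s" for a :: "nat list"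
      using that by (induction a) auto
    with that show ?thesis by blast
  qed
  then have "sum_list ` ?L \<subseteq> {..s * q}" by auto
  then have "(\<Sum>a\<in>?L. z ^ sum_list a) =
      (\<Sum>m\<le>s * q. \<Sum>a\<in>{a \<in> ?L. sum_list a = m}. z ^ sum_list a)"
    using fin by (intro sum.group[symmetric]) auto
  also have "\<dots> = (\<Sum>m\<le>s * q. of_nat (C0 m q s) * z ^ m)"
    by (intro sum.cong) (auto simp: C0_def conj_assoc)
  finally show ?thesis by (simp add: geometric_sum_power_lists)
qed

lemma norm_geometric_sum_eq_tan:
  fixes \<phi> :: real
  defines "z \<equiv> - cis (2 * \<phi>)"
  assumes "cos \<phi> \<noteq> 0" and "z ^ n = -1" and "n \<ge> 2"
  shows "norm (\<Sum>j\<le>n - 2. z ^ j) = \<bar>tan \<phi>\<bar>"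
proof -
  let ?P = "\<Sum>j\<le>n - 2. z ^ j"
  have n: "n = Suc (Suc (n - 2))" using assms(4) by simp
  have "(1 - z) * ?P = 1 - z ^ Suc (n - 2)"
    by (metis sum_gp_basic)
  \<comment> \<open>The extra factor \<open>z\<close> raises the exponent \<open>n - 1\<close> to
    \<open>n\<close>, so that \<open>z ^ n = -1\<close> applies; since \<open>norm z = 1\<close>, it
    does not change the norm.\<close>
  then have "(1 - z) * ?P * z = (1 - z ^ Suc (n - 2)) * z" by simp
  also have "\<dots> = z - z ^ Suc (Suc (n - 2))" by (simp add: left_diff_distrib)
  also have "\<dots> = z - z ^ n" using n by simp
  finally have "(1 - z) * ?P * z = z - z ^ n" .
  then have eq: "norm (1 - z) * norm ?P * norm z = norm (1 + z)"
    using assms(3) by (metis add.commute diff_minus_eq_add norm_mult)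
  have "1 + z = (-2 * \<i> * sin \<phi>) * cis \<phi>" "1 - z = (2 * cos \<phi>) * cis \<phi>"
    unfolding z_def
    by (simp_all add: complex_eq_iff cos_double sin_double cos_squared_eq mult.assoc flip: power2_eq_square)
  then have "norm (1 + z) = 2 * \<bar>sin \<phi>\<bar>" "norm (1 - z) = 2 * \<bar>cos \<phi>\<bar>"
    by (simp_all add: norm_mult)
  with eq assms(2) show ?thesis
    by (simp add: z_def tan_def field_simps)
qed

text \<open>On the unit circle \<open>cnj z\<close> is the inverse of \<open>z\<close>, so each term
  is \<open>z ^ (i - j)\<close>. Up to a sign independent of \<open>m\<close>, these form a
  geometric progression in \<open>m\<close> whose ratio is an \<open>n\<close>-th root of
  unity.\<close>

lemma sum_roots_of_minus_one:
  assumes "odd n" and "j \<le> i"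
  shows "(\<Sum>m<n. let z = - cis (2 * pi * real m / real n) in z ^ i * cnj z ^ j) =
    (if n dvd i - j then of_nat n * (-1) ^ ((i - j) div n) else 0)"
proof -
  have n: "n > 0" using assms(1) by (cases n) auto
  let ?w = "cis (2 * pi * real (i - j) / real n)"
  have term_eq: "(let z = - cis (2 * pi * real m / real n) in z ^ i * cnj z ^ j) =
      (-1) ^ (i - j) * ?w ^ m" for m
  proof -
    define z where "z = - cis (2 * pi * real m / real n)"
    have "z * cnj z = 1" by (simp add: z_def cis_cnj cis_mult)
    moreover have "z ^ i * cnj z ^ j = z ^ (i - j) * (z * cnj z) ^ j"
      using assms(2) by (simp add: power_mult_distrib mult.assoc[symmetric] flip: power_add)
    ultimately have "z ^ i * cnj z ^ j = z ^ (i - j)" by simp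
    also have "\<dots> = (-1) ^ (i - j) * cis (2 * pi * real m / real n) ^ (i - j)"
      unfolding z_def by (rule power_minus)
    also have "cis (2 * pi * real m / real n) ^ (i - j) = ?w ^ m"
      by (simp add: Complex.DeMoivre mult_ac)
    finally show ?thesis by (simp add: z_def)
  qed
  have w1: "?w = 1 \<longleftrightarrow> n dvd i - j"
    using complex_root_unity_eq_1[of n "i - j"] n
    by (simp add: cis_conv_exp mult_ac)
  have "?w ^ n = cis (2 * pi * real (i - j))"
    using n by (simp add: Complex.DeMoivre)
  then have wn: "?w ^ n = 1" by (simp add: cis_multiple_2pi)
  have "(\<Sum>m<n. ?w ^ m) = (if n dvd i - j then of_nat n else 0)"
    using w1 wn geometric_sum[of ?w n] by auto
  \<comment> \<open>As \<open>n\<close> is odd, \<open>n * k\<close> and \<open>k\<close> have the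
    same parity. This is the origin of the alternating sign in the final formula.\<close>
  moreover have "(-1 :: complex) ^ (i - j) = (-1) ^ ((i - j) div n)" if "n dvd i - j"
    using that assms(1) by (elim dvdE) (simp add: power_mult n)
  ultimately show ?thesis
    unfolding term_eq by (simp flip: sum_distrib_left)
qed

text \<open>This reduces a double sum to pairs with \<open>j \<le> i\<close>, for which the natural
  number difference \<open>i - j\<close> is not truncated.\<close>

lemma sum_square_symmetric:
  fixes f :: "nat \<Rightarrow> nat \<Rightarrow> 'a::comm_semiring_1"
  assumes "\<And>i j. f i j = f j i"
  shows "(\<Sum>i\<le>N. \<Sum>j\<le>N. f i j) = (\<Sum>j\<le>N. f j j + 2 * (\<Sum>i\<in>{j<..N}. f i j))"
proof (induction N)
  case (Suc N)
  have *: "(\<Sum>i\<in>{j<..Suc N}. f i j) = (\<Sum>i\<in>{j<..N}. f i j) + f (Suc N) j" if "j \<le> N" for j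
  proof -
    have "{j<..Suc N} = insert (Suc N) {j<..N}" using that by auto
    then show ?thesis by (simp add: add.commute)
  qed
  have "(\<Sum>i\<le>N. f i (Suc N)) = (\<Sum>j\<le>N. f (Suc N) j)"
    using assms by (rule sum.cong[OF refl])
  with Suc.IH show ?case
    by (simp add: * sum.distrib distrib_left mult_2 add_ac flip: sum_distrib_left)
qed simp

text \<open>The substitution is \<open>i = j + n * k\<close>. The quotient is a separate argument of
  \<open>g\<close> so that \<open>g\<close> can carry the sign \<open>(-1) ^ k\<close>.\<close>

lemma sum_multiples_above:
  fixes g :: "nat \<Rightarrow> nat \<Rightarrow> 'a::comm_monoid_add"
  assumes "n > 0"
  shows "(\<Sum>i\<in>{j<..N}. if n dvd i - j then g i ((i - j) div n) else 0) =
    (\<Sum>k=1..(N - j) div n. g (j + n * k) k)"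
proof -
  have "(\<Sum>i\<in>{j<..N}. if n dvd i - j then g i ((i - j) div n) else 0) =
      (\<Sum>i\<in>{i \<in> {j<..N}. n dvd i - j}. g i ((i - j) div n))"
    by (rule sum.inter_filter[symmetric]) simp
  also have "\<dots> = (\<Sum>k=1..(N - j) div n. g (j + n * k) k)"
  proof (rule sum.reindex_bij_witness[of _ "\<lambda>k. j + n * k" "\<lambda>i. (i - j) div n"])
    fix i assume i: "i \<in> {i \<in> {j<..N}. n dvd i - j}"
    then have "(i - j) div n \<le> (N - j) div n" by (intro div_le_mono) auto
    moreover have "(i - j) div n \<noteq> 0" using i by (auto simp: dvd_div_eq_0_iff)
    ultimately show "(i - j) div n \<in> {1..(N - j) div n}" by simp
  next
    fix k assume k: "k \<in> {1..(N - j) div n}"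
    then have "n * k \<le> N - j"
      using assms by (simp add: less_eq_div_iff_mult_less_eq mult.commute)
    moreover have "n * k > 0" using k assms by simp
    ultimately have "j < j + n * k" "j + n * k \<le> N" by linarith+
    then show "j + n * k \<in> {i \<in> {j<..N}. n dvd i - j}" by simp
  qed (use assms in auto)
  finally show ?thesis .
qed

lemma parseval_roots_of_minus_one:
  fixes c :: "nat \<Rightarrow> real"
  assumes "odd n"
  shows "(\<Sum>m<n. (norm (\<Sum>j\<le>N. c j * (- cis (2 * pi * real m / real n)) ^ j))\<^sup>2) =
    real n * (\<Sum>j\<le>N. (c j)\<^sup>2 + 2 * (\<Sum>k=1..(N - j) div n. (-1) ^ k * c j * c (j + n * k)))"
proof -
  have n: "n > 0" using assms by (cases n) auto
  define z where "z m = - cis (2 * pi * real m / real n)" for m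
  \<comment> \<open>Exchanging \<open>i\<close> and \<open>j\<close> conjugates the sum, so its real
    part is symmetric, and the values for \<open>j \<le> i\<close> suffice.\<close>
  define S where "S i j = Re (\<Sum>m<n. z m ^ i * cnj (z m) ^ j)" for i j
  have S: "S i j = (if n dvd i - j then real n * (-1) ^ ((i - j) div n) else 0)" if "j \<le> i" for i j
  proof -
    have "(\<Sum>m<n. z m ^ i * cnj (z m) ^ j) =
        of_real (if n dvd i - j then real n * (-1) ^ ((i - j) div n) else 0)"
      using sum_roots_of_minus_one[OF assms that] by (simp add: z_def Let_def)
    then show ?thesis by (simp only: S_def Re_complex_of_real)
  qed
  have sym: "c i * c j * S i j = c j * c i * S j i" for i j
  proof -
    have "S i j = Re (cnj (\<Sum>m<n. z m ^ j * cnj (z m) ^ i))"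
      by (simp add: S_def mult.commute)
    also have "\<dots> = S j i" unfolding S_def by (rule cnj.simps(1))
    finally show ?thesis by (simp add: mult.commute)
  qed
  have Re_of_real_mult: "Re (of_real a * w) = a * Re w" for a w by simp
  have norm_eq: "(norm (\<Sum>j\<le>N. c j * z m ^ j))\<^sup>2 =
      (\<Sum>i\<le>N. \<Sum>j\<le>N. c i * c j * Re (z m ^ i * cnj (z m) ^ j))" for m
  proof -
    have "complex_of_real ((norm (\<Sum>j\<le>N. c j * z m ^ j))\<^sup>2) =
        (\<Sum>i\<le>N. \<Sum>j\<le>N. of_real (c i * c j) * (z m ^ i * cnj (z m) ^ j))"
      by (simp only: complex_norm_square) (simp add: sum_product mult_ac)
    then have "(norm (\<Sum>j\<le>N. c j * z m ^ j))\<^sup>2 =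
        Re (\<Sum>i\<le>N. \<Sum>j\<le>N. of_real (c i * c j) * (z m ^ i * cnj (z m) ^ j))"
      by (metis Re_complex_of_real)
    also have "\<dots> = (\<Sum>i\<le>N. \<Sum>j\<le>N. c i * c j * Re (z m ^ i * cnj (z m) ^ j))"
      by (simp only: Re_sum Re_of_real_mult)
    finally show ?thesis .
  qed
  have "(\<Sum>m<n. (norm (\<Sum>j\<le>N. c j * z m ^ j))\<^sup>2) = (\<Sum>i\<le>N. \<Sum>j\<le>N. c i * c j * S i j)"
    unfolding norm_eq S_def Re_sum sum_distrib_left
    \<comment> \<open>The sum over \<open>m\<close> moves inwards past \<open>i\<close> first and
      then past \<open>j\<close>.\<close>
    by (rule trans[OF sum.swap], rule sum.cong[OF refl], rule sum.swap)
  also have "\<dots> = (\<Sum>j\<le>N. c j * c j * S j j + 2 * (\<Sum>i\<in>{j<..N}. c i * c j * S i j))"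
    using sym by (rule sum_square_symmetric)
  also have "\<dots> = (\<Sum>j\<le>N. real n * ((c j)\<^sup>2 +
      2 * (\<Sum>k=1..(N - j) div n. (-1) ^ k * c j * c (j + n * k))))"
  proof (intro sum.cong refl)
    fix j
    have "(\<Sum>i\<in>{j<..N}. c i * c j * S i j) = (\<Sum>i\<in>{j<..N}.
        if n dvd i - j then real n * ((-1) ^ ((i - j) div n) * c j * c i) else 0)"
      by (intro sum.cong) (auto simp: S)
    also have "\<dots> = (\<Sum>k=1..(N - j) div n. real n * ((-1) ^ k * c j * c (j + n * k)))"
      using n by (rule sum_multiples_above)
    finally show "c j * c j * S j j + 2 * (\<Sum>i\<in>{j<..N}. c i * c j * S i j) = real n * ((c j)\<^sup>2 +
      2 * (\<Sum>k=1..(N - j) div n. (-1) ^ k * c j * c (j + n * k)))"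
      by (simp add: S power2_eq_square distrib_left flip: sum_distrib_left)
  qed
  finally show ?thesis by (simp add: z_def sum_distrib_left)
qed

text \<open>The reflection of \<open>m\<close> to \<open>n - m\<close> only changes the sign of the
  tangent, which the even power removes. The term at \<open>m = 0\<close> vanishes because
  \<open>p \<ge> 1\<close>.\<close>

lemma two_sigma_eq_full_sum:
  assumes "odd n" and "p \<ge> 1"
  shows "2 * sigma n p = (\<Sum>m<n. tan (pi * real m / real n) ^ (2 * p))"
proof -
  let ?f = "\<lambda>m. tan (pi * real m / real n) ^ (2 * p)"
  obtain h where h: "n = 2 * h + 1" using assms(1) by (elim oddE)
  have refl_eq: "?f (n - m) = ?f m" if "m \<le> n" for m
  proof -
    have "pi * real (n - m) / real n = pi - pi * real m / real n"
      using that h by (simp add: field_simps of_nat_diff)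
    then have "tan (pi * real (n - m) / real n) = - tan (pi * real m / real n)"
      by (simp add: tan_def)
    then show ?thesis by simp
  qed
  have "{..<n} = insert 0 ({1..h} \<union> {h + 1..2 * h})" using h by auto
  then have "(\<Sum>m<n. ?f m) = ?f 0 + ((\<Sum>m=1..h. ?f m) + (\<Sum>m=h + 1..2 * h. ?f m))"
    by (simp add: sum.union_disjoint)
  moreover have "(\<Sum>m=h + 1..2 * h. ?f m) = (\<Sum>m=1..h. ?f m)"
  proof (rule sum.reindex_bij_witness[of _ "\<lambda>m. n - m" "\<lambda>m. n - m"])
    fix m assume "m \<in> {h + 1..2 * h}"
    then show "?f (n - m) = ?f m" using h by (intro refl_eq) auto
  qed (use h in auto)
  ultimately show ?thesis using assms(2) h by (simp add: sigma_def)
qed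

text \<open>A zero would make \<open>2 * m\<close> a product of two odd numbers. Hence no tangent
  here is taken at a pole, where division by zero would give the value 0.\<close>

lemma cos_pi_rational_odd_nonzero:
  assumes "odd n"
  shows "cos (pi * real m / real n) \<noteq> 0"
proof
  assume "cos (pi * real m / real n) = 0"
  then obtain i :: int where i: "odd i" "pi * real m / real n = of_int i * (pi / 2)"
    by (auto simp: cos_zero_iff_int)
  have "n > 0" using assms by (cases n) auto
  with i(2) have "real_of_int (2 * int m) = real_of_int (i * int n)"
    by (simp add: field_simps)
  then have "2 * int m = i * int n" by linarith
  with i(1) assms show False by (metis dvd_triv_left even_mult_iff even_of_nat)
qed

theorem theorem7:
  fixes n p :: nat
  assumes "n \<ge> 3" and "odd n" and "p \<ge> 1"
  shows "sigma n p =
    real n / 2 * (\<Sum>j=0..(n - 2) * p.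
      (real (C0 j p (n - 2)))\<^sup>2 +
      2 * (\<Sum>k=1..((n - 2) * p - j) div n.
        (-1) ^ k * real (C0 j p (n - 2)) * real (C0 (j + n * k) p (n - 2))))"
proof -
  let ?z = "\<lambda>m. - cis (2 * pi * real m / real n)"
  have "(norm (\<Sum>j\<le>(n - 2) * p. real (C0 j p (n - 2)) * ?z m ^ j))\<^sup>2 =
      tan (pi * real m / real n) ^ (2 * p)" for m
  proof -
    have "cis (2 * pi * real m / real n) ^ n = 1"
      using assms(1) by (simp add: Complex.DeMoivre cis_multiple_2pi)
    then have "?z m ^ n = -1" using assms(2) by (simp add: power_minus_odd)
    then have "norm (\<Sum>j\<le>n - 2. ?z m ^ j) = \<bar>tan (pi * real m / real n)\<bar>"
      using norm_geometric_sum_eq_tan[of "pi * real m / real n" n] assms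
        cos_pi_rational_odd_nonzero[of n m] by (simp add: mult.assoc)
    then have "(norm ((\<Sum>j\<le>n - 2. ?z m ^ j) ^ p))\<^sup>2 = tan (pi * real m / real n) ^ (2 * p)"
      by (simp add: norm_power power_even_abs flip: power_mult mult.commute[of 2])
    then show ?thesis by (simp add: geometric_sum_power_C0)
  qed
  then have "2 * sigma n p =
      (\<Sum>m<n. (norm (\<Sum>j\<le>(n - 2) * p. real (C0 j p (n - 2)) * ?z m ^ j))\<^sup>2)"
    using two_sigma_eq_full_sum[OF assms(2,3)] by simp
  \<comment> \<open>The coefficients are \<open>c j = C0 j p (n - 2)\<close> with
    \<open>N = (n - 2) * p\<close>; halving then gives the factor \<open>n / 2\<close>.\<close>
  also note parseval_roots_of_minus_one[OF assms(2)]
  finally show ?thesis by (simp add: atLeast0AtMost)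
qed

end
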